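(* Let $E$ be a finite nonempty set of participants with normalized law invariant risk measures $\rho_i:\mathcal{X}\to\mathbb{R}$ and receivables $R_i$ ($i\in E$), and let $P$ be the $m$-dimensional random payoff vector. Assume that, for every $i\in E$, $\rho_i$ is sensitive to large losses, i.e. $\lim_{\lambda\to\infty}\rho_i(\lambda L)=\infty$ for all $L\in\mathcal{X}$ such that $\mathbb{P}[L>0]>0$. Then there exists a Radner equilibrium on $E$.
   Context: Setting: $(\Omega,\mathcal{A},\mathbb{P})$ is a probability space; $\mathcal{X}$ is a linear subspace of the space $\mathcal{L}^1$ of integrable random variables (identified almost surely) containing the constants; $m\ge 1$; $P$ is a random vector in $\mathbb{R}^m$ and each $R_i$ is a real random variable, with $R_i$ and all components of $P$ in $\mathcal{X}$. A risk measure is a function $\rho:\mathcal{X}\to\mathbb{R}$ that is monotone ($X\le Y$ implies $\rho(X)\le\rho(Y)$), convex ($\rho(\lambda X+(1-\lambda)Y)\le\lambda\rho(X)+(1-\lambda)\rho(Y)$ for $0\le\lambda\le 1$) and translation invariant ($\rho(X-c)=\rho(X)-c$ for $c\in\mathbb{R}$). It is normalized if $\rho(0)=0$ and law invariant if $\rho(X)=\rho(Y)$ whenever $X$ and $Y$ have the same law. Radner equilibrium on $E$: a family $(\mathbf{q}_i)_{i\in E}$ in $\mathbb{R}^m$ and a vector $\mathbf{p}\in\mathbb{R}^m$ such that (optimality) for every $i\in E$ and every $q_i\in\mathbb{R}^m$, $\rho_i(-R_i+\mathbf{q}_i^\top(\mathbf{p}-P))\le\rho_i(-R_i+q_i^\top(\mathbf{p}-P))$,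 and (zero clearing) $\sum_{i\in E}\mathbf{q}_i=0$. *)

theory Defs
  imports "HOL-Probability.Probability"
begin

(* A linear subspace of L^1 that contains the constants. Random variables identified almost surely
   are encoded by their representatives: XX is the set of all representatives of the classes in the
   subspace, which is why it is closed under almost sure equality. *)
definition payoff_space :: "'a measure \<Rightarrow> ('a \<Rightarrow> real) set \<Rightarrow> bool" where
  "payoff_space M XX \<longleftrightarrow>
     (\<forall>X\<in>XX. integrable M X) \<and>
     (\<forall>X\<in>XX. \<forall>Y\<in>borel_measurable M. (AE \<omega> in M. X \<omega> = Y \<omega>) \<longrightarrow> Y \<in> XX) \<and>
     (\<forall>c. (\<lambda>\<omega>. c) \<in> XX) \<and>
     (\<forall>X\<in>XX. \<forall>Y\<in>XX. (\<lambda>\<omega>. X \<omega> + Y \<omega>) \<in> XX) \<and>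
     (\<forall>X\<in>XX. \<forall>c. (\<lambda>\<omega>. c * X \<omega>) \<in> XX)"

(* Only the values of \<rho> on XX matter. Monotonicity is with respect to the almost sure order, hence
   \<rho> takes the same value on representatives of the same class. *)
definition risk_measure :: "'a measure \<Rightarrow> ('a \<Rightarrow> real) set \<Rightarrow> (('a \<Rightarrow> real) \<Rightarrow> real) \<Rightarrow> bool" where
  "risk_measure M XX \<rho> \<longleftrightarrow>
     (\<forall>X\<in>XX. \<forall>Y\<in>XX. (AE \<omega> in M. X \<omega> \<le> Y \<omega>) \<longrightarrow> \<rho> X \<le> \<rho> Y) \<and>
     (\<forall>X\<in>XX. \<forall>Y\<in>XX. \<forall>l. 0 \<le> l \<and> l \<le> 1 \<longrightarrow>
        \<rho> (\<lambda>\<omega>. l * X \<omega> + (1 - l) * Y \<omega>) \<le> l * \<rho> X + (1 - l) * \<rho> Y) \<and>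
     (\<forall>X\<in>XX. \<forall>c. \<rho> (\<lambda>\<omega>. X \<omega> - c) = \<rho> X - c)"

definition normalized :: "(('a \<Rightarrow> real) \<Rightarrow> real) \<Rightarrow> bool" where
  "normalized \<rho> \<longleftrightarrow> \<rho> (\<lambda>\<omega>. 0) = 0"

definition law_invariant :: "'a measure \<Rightarrow> ('a \<Rightarrow> real) set \<Rightarrow> (('a \<Rightarrow> real) \<Rightarrow> real) \<Rightarrow> bool" where
  "law_invariant M XX \<rho> \<longleftrightarrow>
     (\<forall>X\<in>XX. \<forall>Y\<in>XX. distr M borel X = distr M borel Y \<longrightarrow> \<rho> X = \<rho> Y)"

definition sensitive_to_large_losses ::
    "'a measure \<Rightarrow> ('a \<Rightarrow> real) set \<Rightarrow> (('a \<Rightarrow> real) \<Rightarrow> real) \<Rightarrow> bool" where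
  "sensitive_to_large_losses M XX \<rho> \<longleftrightarrow>
     (\<forall>L\<in>XX. measure M {\<omega> \<in> space M. L \<omega> > 0} > 0 \<longrightarrow>
        filterlim (\<lambda>l::real. \<rho> (\<lambda>\<omega>. l * L \<omega>)) at_top at_top)"

definition radner_equilibrium ::
    "'i set \<Rightarrow> ('i \<Rightarrow> ('a \<Rightarrow> real) \<Rightarrow> real) \<Rightarrow> ('i \<Rightarrow> 'a \<Rightarrow> real) \<Rightarrow> ('a \<Rightarrow> real ^ 'm)
       \<Rightarrow> ('i \<Rightarrow> real ^ 'm) \<Rightarrow> real ^ 'm \<Rightarrow> bool" where
  "radner_equilibrium E \<rho> R P q p \<longleftrightarrow>
     (\<forall>i\<in>E. \<forall>r. \<rho> i (\<lambda>\<omega>. - R i \<omega> + q i \<bullet> (p - P \<omega>)) \<le> \<rho> i (\<lambda>\<omega>. - R i \<omega> + r \<bullet> (p - P \<omega>))) \<and>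
     (\<Sum>i\<in>E. q i) = 0"

end

(* Put h_i(q) = rho_i(- R_i - q . (P - mu)) with mu = E P. An equilibrium with price mu - v amounts to
   points q_i with sum 0 such that v is a subgradient of every h_i at q_i; these are obtained from an
   attained infimal convolution of the h_i, with v its subgradient at 0. Attainment needs coercivity
   modulo the portfolios q for which q . (P - mu) vanishes almost surely, along which every h_i is
   constant. For any other q the loss - q . (P - mu) is centred and not almost surely zero, hence
   positive with positive probability, and sensitivity to large losses makes h_i unbounded along q. *)
theory Submission
  imports Defs
begin

section \<open>Subgradients, and projection modulo a subspace\<close>

text \<open>A hyperplane separates the strict epigraph of \<open>g\<close> from the point
  \<open>(x0, g x0)\<close>. As \<open>g\<close> is finite everywhere, the hyperplane is not
  vertical, so its normal can be rescaled to give a slope.\<close>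

lemma convex_imp_subgradient:
  fixes g :: "'b::euclidean_space \<Rightarrow> real"
  assumes "convex_on UNIV g"
  obtains v where "\<And>x. g x0 + v \<bullet> (x - x0) \<le> g x"
proof -
  let ?S = "{z :: 'b \<times> real. g (fst z) < snd z}"
  have convS: "convex ?S"
  proof (rule convexI, clarsimp)
    fix x y s t and u v :: real
    assume *: "g x < s" "g y < t" "0 \<le> u" "0 \<le> v" "u + v = 1"
    have "g (u *\<^sub>R x + v *\<^sub>R y) \<le> u * g x + v * g y"
      using assms * by (auto simp: convex_on_def)
    also have "\<dots> < u * s + v * t"
    proof (cases "u = 0")
      case True
      with * show ?thesis by simp
    next
      case False
      with * have "u * g x < u * s" "v * g y \<le> v * t"
        by (auto intro: mult_left_mono)
      then show ?thesis by linarith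
    qed
    finally show "g (u *\<^sub>R x + v *\<^sub>R y) < u * s + v * t" .
  qed
  have "(x0, g x0 + 1) \<in> ?S" by simp
  then have "?S \<noteq> {}" by blast
  then have "\<exists>a b. a \<noteq> 0 \<and> (\<forall>z\<in>?S. a \<bullet> z \<le> b) \<and> (\<forall>z\<in>{(x0, g x0)}. b \<le> a \<bullet> z)"
    by (intro separating_hyperplane_sets convS) auto
  then obtain a b where ab: "a \<noteq> 0" "\<And>z. z \<in> ?S \<Longrightarrow> a \<bullet> z \<le> b" "b \<le> a \<bullet> (x0, g x0)"
    by blast
  obtain c d where a: "a = (c, d)" by (cases a)
  have sep: "c \<bullet> x + d * y \<le> c \<bullet> x0 + d * g x0" if "g x < y" for x y
    using ab(2)[of "(x, y)"] ab(3) that by (simp add: a)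
  have "d \<le> 0"
    using sep[of x0 "g x0 + 1"] by (simp add: algebra_simps)
  \<comment> \<open>For \<open>d = 0\<close> the hyperplane is vertical; testing it above
    \<open>x0 + c\<close> forces \<open>c = 0\<close>, against \<open>a \<noteq> 0\<close>.\<close>
  moreover have "d \<noteq> 0"
  proof
    assume "d = 0"
    then have "c \<bullet> (x0 + c) \<le> c \<bullet> x0"
      using sep[of "x0 + c" "g (x0 + c) + 1"] by simp
    then have "c \<bullet> c \<le> 0" by (simp add: inner_add_right)
    then have "c = 0" by (metis inner_gt_zero_iff not_le)
    with \<open>d = 0\<close> ab(1) a show False by (simp add: zero_prod_def)
  qed
  ultimately have "d < 0" by simp
  \<comment> \<open>Dividing \<open>sep\<close> by the negative \<open>d\<close> reverses it. It is
    available only for \<open>y\<close> strictly above \<open>g x\<close>, hence the limit by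
    \<open>dense_ge\<close>.\<close>
  have "g x0 + (- c /\<^sub>R d) \<bullet> (x - x0) \<le> g x" for x
  proof (rule dense_ge)
    fix y assume "g x < y"
    from sep[OF this] \<open>d < 0\<close> show "g x0 + (- c /\<^sub>R d) \<bullet> (x - x0) \<le> y"
      by (simp add: field_simps inner_diff_right)
  qed
  then show ?thesis by (rule that)
qed

text \<open>The orthogonal projection onto the complement of \<open>N\<close> does this. It selects
  one representative of each class modulo \<open>N\<close>, so that \<open>norm (\<pi> q)\<close>
  measures size in the quotient.\<close>

lemma projection_along_subspace:
  fixes N :: "'b::euclidean_space set"
  assumes "subspace N"
  obtains \<pi> where "linear \<pi>" "\<And>x. \<pi> (\<pi> x) = \<pi> x" "\<And>x. x - \<pi> x \<in> N" "\<And>x. x \<in> N \<Longrightarrow> \<pi> x = 0"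
proof -
  obtain B where B: "B \<subseteq> N" "pairwise orthogonal B" "\<And>x. x \<in> B \<Longrightarrow> norm x = 1"
      "independent B" "span B = N"
    using orthonormal_basis_subspace[OF assms] by metis
  have fin: "finite B"
    using B(4) by (rule independent_imp_finite)
  define \<pi> where "\<pi> x = x - (\<Sum>b\<in>B. (b \<bullet> x) *\<^sub>R b)" for x
  have lin: "linear \<pi>"
    unfolding \<pi>_def
    by (intro linearI) (simp_all add: inner_add_right scaleR_add_left sum.distrib scaleR_diff_right
        scaleR_sum_right)
  have inN: "x - \<pi> x \<in> N" for x
    unfolding \<pi>_def using B(1) assms by (auto intro!: subspace_sum subspace_scale)
  have orth: "orthogonal (\<pi> x) b" if "b \<in> B" for x b
  proof -
    have "(\<Sum>c\<in>B. (c \<bullet> x) * (c \<bullet> b)) = (\<Sum>c\<in>{b}. (c \<bullet> x) * (c \<bullet> b))"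
      using that fin B(2) by (intro sum.mono_neutral_right) (auto simp: pairwise_def orthogonal_def)
    also have "\<dots> = b \<bullet> x" using B(3)[OF that] by (simp add: dot_square_norm)
    finally show ?thesis
      by (simp add: orthogonal_def \<pi>_def inner_diff_left inner_sum_left inner_commute[of x b])
  qed
  \<comment> \<open>For \<open>x\<close> in \<open>N\<close> the vector \<open>\<pi> x\<close> lies
    in \<open>N\<close> and is orthogonal to a basis of \<open>N\<close>, hence to itself.\<close>
  have zero: "\<pi> x = 0" if "x \<in> N" for x
  proof -
    have "x - (x - \<pi> x) \<in> N"
      by (rule subspace_diff[OF assms that inN])
    then have "\<pi> x \<in> span B" using B(5) by simp
    then have "orthogonal (\<pi> x) (\<pi> x)"
      using orth by (blast intro: orthogonal_to_span)
    then show ?thesis by (simp add: orthogonal_self)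
  qed
  have "\<pi> (\<pi> x) = \<pi> x" for x
    using zero[OF inN, of x] by (simp add: linear_diff[OF lin])
  with lin inN zero show ?thesis by (intro that)
qed

section \<open>Coercivity modulo a subspace\<close>

text \<open>For a linear projection \<open>\<pi>\<close> this means that \<open>h\<close> descends
  to the quotient by the kernel and grows at least linearly there. A linear bound passes to infimal
  convolutions by the triangle inequality.\<close>

definition coercive_along :: "('b::euclidean_space \<Rightarrow> 'b) \<Rightarrow> ('b \<Rightarrow> real) \<Rightarrow> bool" where
  "coercive_along \<pi> h \<longleftrightarrow> convex_on UNIV h \<and> (\<forall>q. h (\<pi> q) = h q) \<and>
     (\<exists>a>0. \<exists>b. \<forall>q. a * norm (\<pi> q) - b \<le> h q)"

text \<open>Compactness of the unit sphere yields one distance \<open>n\<close> at which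
  \<open>h\<close> exceeds \<open>h 0 + 1\<close> in all fixed directions of \<open>\<pi>\<close> at
  once; convexity extrapolates this to linear growth.\<close>

lemma coercive_alongI:
  fixes h :: "'b::euclidean_space \<Rightarrow> real"
  assumes lin: "linear \<pi>" and idem: "\<And>x. \<pi> (\<pi> x) = \<pi> x"
    and conv: "convex_on UNIV h" and inv: "\<And>q. h (\<pi> q) = h q"
    and unbounded: "\<And>u c. \<pi> u = u \<Longrightarrow> u \<noteq> 0 \<Longrightarrow> \<exists>n::nat. c < h (real n *\<^sub>R u)"
  shows "coercive_along \<pi> h"
proof -
  have cont: "continuous_on UNIV h"
    using conv by (intro convex_on_continuous) auto
  have shrink: "h (t *\<^sub>R x) \<le> (1 - t) * h 0 + t * h x" if "0 \<le> t" "t \<le> 1" for t x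
    using convex_onD[OF conv that, of 0 x] by simp
  \<comment> \<open>Unit directions along which \<open>h\<close> has not risen by more than
    \<open>1\<close> at distance \<open>n\<close>. These sets are compact and decreasing, so if none
    were empty, a common direction would contradict \<open>unbounded\<close>.\<close>
  define A where "A n = {u. norm u = 1 \<and> \<pi> u = u \<and> h (real n *\<^sub>R u) \<le> h 0 + 1}" for n
  have "\<exists>n. A n = {}"
  proof (rule ccontr)
    assume ne: "\<not> ?thesis"
    have "continuous_on UNIV \<pi>"
      using lin by (simp add: linear_continuous_on linear_conv_bounded_linear)
    then have closed: "closed (A n)" for n
      unfolding A_def
      by (intro closed_Collect_conj closed_Collect_eq closed_Collect_le continuous_intros
          continuous_on_compose2[OF cont]) auto
    have "bounded (A n)" for n
      unfolding A_def by (rule boundedI[of _ 1]) auto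
    with closed have "compact (A n)" for n
      by (simp add: compact_eq_bounded_closed)
    moreover have "A n \<subseteq> A m" if "m \<le> n" for m n
    proof (cases "n = 0")
      case False
      show ?thesis
      proof
        fix u assume u: "u \<in> A n"
        let ?t = "real m / real n"
        have t: "0 \<le> ?t" "?t \<le> 1" using that False by auto
        \<comment> \<open>The point at distance \<open>m\<close> lies on the segment from
          \<open>0\<close> to the one at distance \<open>n\<close>, so a bound at \<open>n\<close>
          is inherited at \<open>m\<close>.\<close>
        have "h (real m *\<^sub>R u) \<le> (1 - ?t) * h 0 + ?t * h (real n *\<^sub>R u)"
          using shrink[OF t, of "real n *\<^sub>R u"] False by simp
        also have "\<dots> \<le> (1 - ?t) * h 0 + ?t * (h 0 + 1)"
          using u t by (intro add_left_mono mult_left_mono) (auto simp: A_def)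
        also have "\<dots> \<le> h 0 + 1"
          using t by (simp only: distrib_left left_diff_distrib)
        finally show "u \<in> A m" using u by (simp add: A_def)
      qed
    qed (use that in simp)
    ultimately have "\<Inter>(range A) \<noteq> {}"
      using ne by (intro compact_nest) auto
    then obtain u where u: "\<And>n. u \<in> A n" by auto
    then have "\<pi> u = u" "u \<noteq> 0" by (auto simp: A_def)
    from unbounded[OF this, of "h 0 + 1"] obtain n where "h 0 + 1 < h (real n *\<^sub>R u)" ..
    with u[of n] show False by (simp add: A_def)
  qed
  then obtain n where n: "A n = {}" ..
  have large: "h 0 + 1 < h (real n *\<^sub>R u)" if "norm u = 1" "\<pi> u = u" for u
    using n that by (force simp: A_def not_le[symmetric])
  have "\<exists>m. \<forall>q\<in>cball 0 (real n). m \<le> h q"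
    using continuous_attains_inf[of "cball 0 (real n)" h] cont
    by (force intro: continuous_on_subset)
  then obtain m where m: "\<And>q. norm q \<le> real n \<Longrightarrow> m \<le> h q" by (auto simp: Ball_def)
  \<comment> \<open>The \<open>+ 1\<close> keeps \<open>a\<close> positive when
    \<open>n = 0\<close>, where \<open>1 / real n\<close> would be \<open>0\<close>.\<close>
  define a where "a = 1 / (real n + 1)"
  have an: "a * real n \<le> 1" "0 < a" by (auto simp: a_def field_simps)
  \<comment> \<open>In the constant, \<open>\<bar>m\<bar> + 1\<close> serves the ball of radius
    \<open>n\<close>, where \<open>a * norm (\<pi> q) \<le> 1\<close>, and
    \<open>\<bar>h 0\<bar>\<close> serves its exterior.\<close>
  have "a * norm (\<pi> q) - (\<bar>h 0\<bar> + \<bar>m\<bar> + 1) \<le> h q" for q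
  proof (cases "norm (\<pi> q) \<le> real n")
    case True
    then have "a * norm (\<pi> q) \<le> a * real n" using an by (intro mult_left_mono) auto
    moreover have "m \<le> h q" using m[OF True] by (simp add: inv)
    ultimately show ?thesis using an by linarith
  next
    case False
    let ?r = "norm (\<pi> q)"
    let ?u = "\<pi> q /\<^sub>R ?r"
    \<comment> \<open>\<open>?t\<close> locates the point at distance \<open>n\<close> on the
      segment from \<open>0\<close> to \<open>\<pi> q\<close>. Since \<open>h\<close> exceeds
      \<open>h 0 + 1\<close> there, the chord to \<open>\<pi> q\<close> must be steep.\<close>
    let ?t = "real n / ?r"
    have r: "0 < ?r" using False by (meson not_le of_nat_0_le_iff order_trans)
    have t: "0 \<le> ?t" "?t \<le> 1" using False r by auto
    have "h 0 + 1 < h (real n *\<^sub>R ?u)"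
      using r by (intro large) (auto simp: linear_scale[OF lin] idem)
    also have "\<dots> = h (?t *\<^sub>R \<pi> q)" by (simp add: divide_inverse)
    also have "\<dots> \<le> (1 - ?t) * h 0 + ?t * h q"
      using shrink[OF t, of "\<pi> q"] by (simp add: inv)
    finally have "1 < ?t * (h q - h 0)" by (simp only: right_diff_distrib left_diff_distrib)
    then have *: "?r < real n * (h q - h 0)" using r by (simp add: field_simps)
    have "0 < h q - h 0"
    proof (rule ccontr)
      assume "\<not> ?thesis"
      then have "real n * (h q - h 0) \<le> 0" by (simp add: mult_nonneg_nonpos)
      with * r show False by simp
    qed
    with * have "?r < (real n + 1) * (h q - h 0)" by (simp add: distrib_right)
    then have "a * ?r < h q - h 0" by (simp add: a_def field_simps)
    then show ?thesis by linarith
  qed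
  with conv inv an show ?thesis unfolding coercive_along_def by blast
qed

text \<open>Invariance lets \<open>\<pi> q\<close> stand in for \<open>q\<close>, so a minimum over
  a ball is global even if \<open>f\<close> is constant along the kernel of
  \<open>\<pi>\<close>.\<close>

lemma coercive_attains_inf:
  fixes f :: "'b::euclidean_space \<Rightarrow> real"
  assumes cont: "continuous_on UNIV f" and inv: "\<And>q. f (\<pi> q) = f q"
    and "a > 0" and bound: "\<And>q. a * norm (\<pi> q) - b \<le> f q"
  shows "\<exists>q0. \<forall>q. f q0 \<le> f q"
proof -
  \<comment> \<open>Chosen so that \<open>a * norm (\<pi> q) - b\<close> exceeds \<open>f 0\<close>
    once \<open>norm (\<pi> q) > r\<close>; \<open>max 0\<close> keeps \<open>0\<close> in the
    ball.\<close>
  define r where "r = max 0 ((f 0 + b) / a)"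
  have r: "0 \<le> r" "f 0 + b \<le> a * r"
    using \<open>a > 0\<close> by (auto simp: r_def max_def field_simps)
  have "\<exists>q0\<in>cball 0 r. \<forall>q\<in>cball 0 r. f q0 \<le> f q"
    using r by (intro continuous_attains_inf) (auto intro: continuous_on_subset[OF cont])
  then obtain q0 where q0: "\<And>q. norm q \<le> r \<Longrightarrow> f q0 \<le> f q" by (auto simp: Ball_def)
  have "f q0 \<le> f q" for q
  proof (cases "norm (\<pi> q) \<le> r")
    case True
    from q0[OF this] show ?thesis by (simp add: inv)
  next
    case False
    then have "a * r \<le> a * norm (\<pi> q)" using \<open>a > 0\<close> by simp
    with bound[of q] r q0[of 0] show ?thesis by simp
  qed
  then show ?thesis by blast
qed

section \<open>Infimal convolution and a common subgradient\<close>

text \<open>For fixed \<open>s\<close>, the growth of \<open>h\<close> and the lower bound of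
  \<open>k\<close> make the minimum over \<open>q\<close> attained. Convexity, invariance and growth
  of \<open>g\<close> then follow from those of \<open>h\<close> and \<open>k\<close> at the
  minimisers \<open>Q s\<close>.\<close>

lemma coercive_along_inf_convolution:
  fixes h k :: "'b::euclidean_space \<Rightarrow> real"
  assumes lin: "linear \<pi>" and idem: "\<And>x. \<pi> (\<pi> x) = \<pi> x"
    and "coercive_along \<pi> h" "coercive_along \<pi> k"
  obtains g where "coercive_along \<pi> g" "\<And>s q. g s \<le> h q + k (s - q)"
    "\<And>s. \<exists>q. g s = h q + k (s - q)"
proof -
  obtain a b where h: "convex_on UNIV h" "\<And>q. h (\<pi> q) = h q"
      "a > 0" "\<And>q. a * norm (\<pi> q) - b \<le> h q"
    using assms(3) unfolding coercive_along_def by blast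
  obtain a' b' where k: "convex_on UNIV k" "\<And>q. k (\<pi> q) = k q"
      "a' > 0" "\<And>q. a' * norm (\<pi> q) - b' \<le> k q"
    using assms(4) unfolding coercive_along_def by blast
  have conth: "continuous_on UNIV h" and contk: "continuous_on UNIV k"
    using h k by (auto intro: convex_on_continuous)
  have k_diff: "k (s - \<pi> q) = k (s - q)" "k (\<pi> s - q) = k (s - q)" for s q
  proof -
    have "\<pi> (s - \<pi> q) = \<pi> (s - q)" "\<pi> (\<pi> s - q) = \<pi> (s - q)"
      by (simp_all add: linear_diff[OF lin] idem)
    then show "k (s - \<pi> q) = k (s - q)" "k (\<pi> s - q) = k (s - q)"
      by (metis k(2))+
  qed
  have "\<exists>q0. \<forall>q. h q0 + k (s - q0) \<le> h q + k (s - q)" for s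
  proof (rule coercive_attains_inf)
    show "continuous_on UNIV (\<lambda>q. h q + k (s - q))"
      by (intro continuous_intros continuous_on_compose2[OF contk] conth) auto
    show "h (\<pi> q) + k (s - \<pi> q) = h q + k (s - q)" for q
      by (simp add: h k_diff)
    show "a * norm (\<pi> q) - (b + b') \<le> h q + k (s - q)" for q
    proof -
      have "0 \<le> a' * norm (\<pi> (s - q))" using k(3) by simp
      then show ?thesis using h(4)[of q] k(4)[of "s - q"] by linarith
    qed
  qed (rule h(3))
  then obtain Q where Q: "\<And>s q. h (Q s) + k (s - Q s) \<le> h q + k (s - q)" by metis
  define g where "g s = h (Q s) + k (s - Q s)" for s
  have le: "g s \<le> h q + k (s - q)" for s q by (simp add: g_def Q)
  have "convex_on UNIV g"
    unfolding convex_on_def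
  proof (intro conjI ballI allI impI)
    fix x y :: 'b and u v :: real
    assume uv: "0 \<le> u" "0 \<le> v" "u + v = 1"
    \<comment> \<open>The combination of the minimisers for \<open>x\<close> and \<open>y\<close>
      competes at the combined point.\<close>
    have "g (u *\<^sub>R x + v *\<^sub>R y)
        \<le> h (u *\<^sub>R Q x + v *\<^sub>R Q y) + k (u *\<^sub>R (x - Q x) + v *\<^sub>R (y - Q y))"
      using le[of "u *\<^sub>R x + v *\<^sub>R y" "u *\<^sub>R Q x + v *\<^sub>R Q y"] by (simp add: algebra_simps)
    also have "\<dots> \<le> (u * h (Q x) + v * h (Q y)) + (u * k (x - Q x) + v * k (y - Q y))"
      using h(1) k(1) uv unfolding convex_on_def by (intro add_mono) auto
    finally show "g (u *\<^sub>R x + v *\<^sub>R y) \<le> u * g x + v * g y"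
      by (simp add: g_def algebra_simps)
  qed simp
  \<comment> \<open>The minimiser for \<open>s\<close> competes for \<open>\<pi> s\<close> at equal
    cost, and conversely.\<close>
  moreover have "g (\<pi> s) = g s" for s
    using le[of "\<pi> s" "Q s"] le[of s "Q (\<pi> s)"] by (simp add: g_def k_diff)
  moreover have "min a a' * norm (\<pi> s) - (b + b') \<le> g s" for s
  proof -
    \<comment> \<open>The size of \<open>\<pi> s\<close> is shared between the two parts of the
      splitting, and each part costs at least the rate \<open>min a a'\<close>.\<close>
    have "norm (\<pi> s) \<le> norm (\<pi> (Q s)) + norm (\<pi> (s - Q s))"
      using norm_triangle_ineq[of "\<pi> (Q s)" "\<pi> (s - Q s)"] by (simp add: linear_diff[OF lin])
    then have "min a a' * norm (\<pi> s)
        \<le> min a a' * norm (\<pi> (Q s)) + min a a' * norm (\<pi> (s - Q s))"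
      using h(3) k(3) unfolding distrib_left[symmetric] by (intro mult_left_mono) auto
    also have "\<dots> \<le> a * norm (\<pi> (Q s)) + a' * norm (\<pi> (s - Q s))"
      by (intro add_mono mult_right_mono) auto
    finally show ?thesis
      using h(4)[of "Q s"] k(4)[of "s - Q s"] by (simp add: g_def)
  qed
  ultimately have "coercive_along \<pi> g"
    unfolding coercive_along_def using h(3) k(3) by (metis min_less_iff_conj)
  then show ?thesis
    using le by (rule that) (auto simp: g_def)
qed

text \<open>Induction on \<open>E\<close>: a new participant \<open>j\<close> is added by convolving
  \<open>h j\<close> with the convolution of the others.\<close>

lemma coercive_along_inf_convolution_finite:
  fixes h :: "'i \<Rightarrow> 'b::euclidean_space \<Rightarrow> real"
  assumes lin: "linear \<pi>" and idem: "\<And>x. \<pi> (\<pi> x) = \<pi> x"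
    and "finite E" "E \<noteq> {}" "\<And>i. i \<in> E \<Longrightarrow> coercive_along \<pi> (h i)"
  shows "\<exists>g. coercive_along \<pi> g \<and> (\<forall>q. g (\<Sum>i\<in>E. q i) \<le> (\<Sum>i\<in>E. h i (q i))) \<and>
           (\<forall>s. \<exists>q. (\<Sum>i\<in>E. q i) = s \<and> g s = (\<Sum>i\<in>E. h i (q i)))"
  using assms(3-5)
proof (induction rule: finite_ne_induct)
  case (singleton i)
  then show ?case by (intro exI[of _ "h i"]) auto
next
  case (insert j F)
  then obtain g where g: "coercive_along \<pi> g"
      "\<And>q. g (\<Sum>i\<in>F. q i) \<le> (\<Sum>i\<in>F. h i (q i))"
      "\<And>s. \<exists>q. (\<Sum>i\<in>F. q i) = s \<and> g s = (\<Sum>i\<in>F. h i (q i))"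
    by force
  obtain f where f: "coercive_along \<pi> f" "\<And>s q. f s \<le> h j q + g (s - q)"
      "\<And>s. \<exists>q. f s = h j q + g (s - q)"
    using coercive_along_inf_convolution[OF lin idem, of "h j" g] insert.prems g(1) by blast
  have "f (\<Sum>i\<in>insert j F. q i) \<le> (\<Sum>i\<in>insert j F. h i (q i))" for q
    using f(2)[of "\<Sum>i\<in>insert j F. q i" "q j"] g(2)[of q] insert.hyps by simp
  moreover have "\<exists>q. (\<Sum>i\<in>insert j F. q i) = s \<and> f s = (\<Sum>i\<in>insert j F. h i (q i))" for s
  proof -
    obtain r where r: "f s = h j r + g (s - r)" using f(3) by blast
    obtain q where q: "(\<Sum>i\<in>F. q i) = s - r" "g (s - r) = (\<Sum>i\<in>F. h i (q i))"
      using g(3) by blast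
    have "(\<Sum>i\<in>F. (q(j := r)) i) = (\<Sum>i\<in>F. q i)"
      "(\<Sum>i\<in>F. h i ((q(j := r)) i)) = (\<Sum>i\<in>F. h i (q i))"
      using insert.hyps by (auto intro!: sum.cong split: if_splits)
    then show ?thesis
      using insert.hyps q r by (intro exI[of _ "q(j := r)"]) simp
  qed
  ultimately show ?case using f(1) by blast
qed

text \<open>Take an optimal splitting of \<open>0\<close> and a subgradient \<open>v\<close> of the
  convolution at \<open>0\<close>. If only \<open>i\<close> moves, from \<open>q i\<close> to
  \<open>r\<close>, the total becomes \<open>r - q i\<close>, and the subgradient inequality there
  bounds the change of \<open>h i\<close> below by \<open>v \<bullet> (r - q i)\<close>.\<close>

lemma coercive_along_equilibrium:
  fixes h :: "'i \<Rightarrow> 'b::euclidean_space \<Rightarrow> real"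
  assumes "linear \<pi>" "\<And>x. \<pi> (\<pi> x) = \<pi> x"
    and fin: "finite E" and "E \<noteq> {}" "\<And>i. i \<in> E \<Longrightarrow> coercive_along \<pi> (h i)"
  obtains q v where "(\<Sum>i\<in>E. q i) = 0"
    "\<And>i r. i \<in> E \<Longrightarrow> h i (q i) - v \<bullet> q i \<le> h i r - v \<bullet> r"
proof -
  obtain g where g: "coercive_along \<pi> g"
      "\<And>q. g (\<Sum>i\<in>E. q i) \<le> (\<Sum>i\<in>E. h i (q i))"
      "\<And>s. \<exists>q. (\<Sum>i\<in>E. q i) = s \<and> g s = (\<Sum>i\<in>E. h i (q i))"
    using coercive_along_inf_convolution_finite[of \<pi> E h, OF assms] by blast
  obtain q where q: "(\<Sum>i\<in>E. q i) = 0" "g 0 = (\<Sum>i\<in>E. h i (q i))" using g(3) by blast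
  obtain v where v: "\<And>x. g 0 + v \<bullet> (x - 0) \<le> g x"
    using convex_imp_subgradient[of g 0] g(1) unfolding coercive_along_def by blast
  have "h i (q i) - v \<bullet> q i \<le> h i r - v \<bullet> r" if i: "i \<in> E" for i r
  proof -
    have others: "(\<Sum>j\<in>E - {i}. (q(i := r)) j) = (\<Sum>j\<in>E - {i}. q j)"
      "(\<Sum>j\<in>E - {i}. h j ((q(i := r)) j)) = (\<Sum>j\<in>E - {i}. h j (q j))"
      by (auto intro!: sum.cong)
    have "(\<Sum>j\<in>E. (q(i := r)) j) = r - q i"
      using q(1) others sum.remove[OF fin i, of q] sum.remove[OF fin i, of "q(i := r)"]
      by (simp add: eq_neg_iff_add_eq_0 add.commute)
    moreover have "(\<Sum>j\<in>E. h j ((q(i := r)) j)) = g 0 - h i (q i) + h i r"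
      using q(2) others sum.remove[OF fin i, of "\<lambda>j. h j (q j)"]
        sum.remove[OF fin i, of "\<lambda>j. h j ((q(i := r)) j)"] by simp
    ultimately have "g (r - q i) \<le> g 0 - h i (q i) + h i r"
      using g(2)[of "q(i := r)"] by simp
    with v[of "r - q i"] show ?thesis by (simp add: inner_diff_right)
  qed
  with q(1) show ?thesis by (rule that)
qed

section \<open>Payoff spaces, centred payoffs and risk measures\<close>

lemma payoff_space_const: "payoff_space M XX \<Longrightarrow> (\<lambda>\<omega>. c) \<in> XX"
  by (simp add: payoff_space_def)

lemma payoff_space_add:
  "payoff_space M XX \<Longrightarrow> X \<in> XX \<Longrightarrow> Y \<in> XX \<Longrightarrow> (\<lambda>\<omega>. X \<omega> + Y \<omega>) \<in> XX"
  by (simp add: payoff_space_def)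

lemma payoff_space_cmult:
  "payoff_space M XX \<Longrightarrow> X \<in> XX \<Longrightarrow> (\<lambda>\<omega>. c * X \<omega>) \<in> XX"
  by (simp add: payoff_space_def)

lemma payoff_space_sum:
  assumes "payoff_space M XX" "finite A" "\<And>i. i \<in> A \<Longrightarrow> X i \<in> XX"
  shows "(\<lambda>\<omega>. \<Sum>i\<in>A. X i \<omega>) \<in> XX"
  using assms(2,3)
proof (induction A rule: finite_induct)
  case empty
  then show ?case using assms(1) by (simp add: payoff_space_def)
next
  case (insert i A)
  then show ?case using assms(1) by (simp add: payoff_space_def)
qed

lemma payoff_space_inner:
  fixes P :: "'a \<Rightarrow> real ^ 'm"
  assumes XX: "payoff_space M XX" and "\<And>j. (\<lambda>\<omega>. P \<omega> $ j) \<in> XX"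
  shows "(\<lambda>\<omega>. q \<bullet> (P \<omega> - c)) \<in> XX"
proof -
  have "(\<lambda>\<omega>. q $ j * (P \<omega> $ j + - (c $ j))) \<in> XX" for j
    by (intro payoff_space_cmult[OF XX] payoff_space_add[OF XX] payoff_space_const[OF XX] assms(2))
  from payoff_space_sum[OF XX finite_class.finite_UNIV this]
  show ?thesis by (simp add: inner_vec_def)
qed

lemma (in prob_space) expectation_inner_centered:
  fixes P :: "'a \<Rightarrow> real ^ 'm"
  assumes "\<And>j. integrable M (\<lambda>\<omega>. P \<omega> $ j)"
  shows "expectation (\<lambda>\<omega>. q \<bullet> (P \<omega> - (\<chi> j. expectation (\<lambda>\<omega>. P \<omega> $ j)))) = 0"
  using assms by (simp add: inner_vec_def prob_space)

text \<open>Otherwise \<open>- L\<close> is almost surely nonnegative with integral zero, hence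
  almost surely zero.\<close>

lemma (in prob_space) measure_pos_of_centered:
  fixes L :: "'a \<Rightarrow> real"
  assumes L: "integrable M L" and "expectation L = 0" and "\<not> (AE \<omega> in M. L \<omega> = 0)"
  shows "measure M {\<omega> \<in> space M. L \<omega> > 0} > 0"
proof (rule ccontr)
  have meas [measurable]: "L \<in> borel_measurable M" using L by (rule borel_measurable_integrable)
  assume "\<not> ?thesis"
  then have "prob {\<omega> \<in> space M. L \<omega> > 0} = 0"
    by (simp add: order.antisym not_less)
  then have "AE \<omega> in M. \<not> 0 < L \<omega>"
    by (subst (asm) prob_eq_0) auto
  then have "AE \<omega> in M. 0 \<le> - L \<omega>" by eventually_elim auto
  moreover have "expectation (\<lambda>\<omega>. - L \<omega>) = 0" using assms(2) by simp
  ultimately have "AE \<omega> in M. - L \<omega> = 0"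
    using L integral_nonneg_eq_0_iff_AE[of M "\<lambda>\<omega>. - L \<omega>"] by simp
  with assms(3) show False by simp
qed

lemma risk_measure_convex:
  "risk_measure M XX \<rho> \<Longrightarrow> X \<in> XX \<Longrightarrow> Y \<in> XX \<Longrightarrow> 0 \<le> l \<Longrightarrow> l \<le> 1 \<Longrightarrow>
    \<rho> (\<lambda>\<omega>. l * X \<omega> + (1 - l) * Y \<omega>) \<le> l * \<rho> X + (1 - l) * \<rho> Y"
  by (simp add: risk_measure_def)

lemma risk_measure_cong_AE:
  assumes "risk_measure M XX \<rho>" "X \<in> XX" "Y \<in> XX" "AE \<omega> in M. X \<omega> = Y \<omega>"
  shows "\<rho> X = \<rho> Y"
proof (rule order.antisym)
  have "AE \<omega> in M. X \<omega> \<le> Y \<omega>" "AE \<omega> in M. Y \<omega> \<le> X \<omega>"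
    using assms(4) by (eventually_elim, simp)+
  then show "\<rho> X \<le> \<rho> Y" "\<rho> Y \<le> \<rho> X"
    using assms(1-3) unfolding risk_measure_def by blast+
qed

text \<open>Sensitivity is only assumed along rays starting at \<open>0\<close>; by convexity at the midpoint of
  \<open>l L - R\<close> and \<open>R\<close>, the base point of the ray is irrelevant.\<close>

lemma sensitive_shifted_ray:
  assumes XX: "payoff_space M XX" and \<rho>: "risk_measure M XX \<rho>"
    and sens: "sensitive_to_large_losses M XX \<rho>"
    and L: "L \<in> XX" "measure M {\<omega> \<in> space M. L \<omega> > 0} > 0" and R: "R \<in> XX"
  shows "\<exists>n::nat. c < \<rho> (\<lambda>\<omega>. real n * L \<omega> - R \<omega>)"
proof -
  have "filterlim (\<lambda>l::real. \<rho> (\<lambda>\<omega>. l * L \<omega>)) at_top at_top"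
    using sens L unfolding sensitive_to_large_losses_def by blast
  \<comment> \<open>The threshold that the midpoint inequality below turns into
    \<open>c\<close>.\<close>
  then have "\<forall>\<^sub>F l in at_top. (c + \<rho> R) / 2 < \<rho> (\<lambda>\<omega>. l * L \<omega>)"
    unfolding filterlim_at_top_dense by blast
  then obtain l0 where l0: "\<And>l. l \<ge> l0 \<Longrightarrow> (c + \<rho> R) / 2 < \<rho> (\<lambda>\<omega>. l * L \<omega>)"
    by (auto simp: eventually_at_top_linorder)
  \<comment> \<open>The factor \<open>2\<close> is due to the midpoint, which lies at
    \<open>real n / 2\<close> on the ray of \<open>L\<close>.\<close>
  obtain n :: nat where n: "2 * l0 \<le> real n" using real_arch_simple by blast
  have "(\<lambda>\<omega>. real n * L \<omega> + - 1 * R \<omega>) \<in> XX"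
    by (intro payoff_space_cmult[OF XX] payoff_space_add[OF XX] L R)
  then have "(\<lambda>\<omega>. real n * L \<omega> - R \<omega>) \<in> XX" by simp
  then have "\<rho> (\<lambda>\<omega>. (1/2) * (real n * L \<omega> - R \<omega>) + (1 - 1/2) * R \<omega>)
      \<le> (1/2) * \<rho> (\<lambda>\<omega>. real n * L \<omega> - R \<omega>) + (1 - 1/2) * \<rho> R"
    using risk_measure_convex[OF \<rho> _ R, of _ "1/2"] by simp
  also have "(\<lambda>\<omega>. (1/2) * (real n * L \<omega> - R \<omega>) + (1 - 1/2) * R \<omega>)
      = (\<lambda>\<omega>. real n / 2 * L \<omega>)"
    by (simp add: fun_eq_iff field_simps)
  finally have "\<rho> (\<lambda>\<omega>. real n / 2 * L \<omega>)
      \<le> (1/2) * \<rho> (\<lambda>\<omega>. real n * L \<omega> - R \<omega>) + (1 - 1/2) * \<rho> R" .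
  moreover have "(c + \<rho> R) / 2 < \<rho> (\<lambda>\<omega>. real n / 2 * L \<omega>)"
    using n by (intro l0) simp
  ultimately have "c < \<rho> (\<lambda>\<omega>. real n * L \<omega> - R \<omega>)"
    by argo
  then show ?thesis ..
qed

section \<open>From risk measures to the equilibrium price\<close>

theorem theorem2p2:
  fixes M :: "'a measure"
    and XX :: "('a \<Rightarrow> real) set"
    and E :: "'i set"
    and \<rho> :: "'i \<Rightarrow> ('a \<Rightarrow> real) \<Rightarrow> real"
    and R :: "'i \<Rightarrow> 'a \<Rightarrow> real"
    and P :: "'a \<Rightarrow> real ^ 'm"
  assumes "prob_space M"
    and "payoff_space M XX"
    and "finite E" and "E \<noteq> {}"
    and "\<And>j. (\<lambda>\<omega>. P \<omega> $ j) \<in> XX"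
    and "\<And>i. i \<in> E \<Longrightarrow> R i \<in> XX"
    and "\<And>i. i \<in> E \<Longrightarrow> risk_measure M XX (\<rho> i)"
    and "\<And>i. i \<in> E \<Longrightarrow> normalized (\<rho> i)"
    and "\<And>i. i \<in> E \<Longrightarrow> law_invariant M XX (\<rho> i)"
    and "\<And>i. i \<in> E \<Longrightarrow> sensitive_to_large_losses M XX (\<rho> i)"
  shows "\<exists>(q :: 'i \<Rightarrow> real ^ 'm) (p :: real ^ 'm). radner_equilibrium E \<rho> R P q p"
proof -
  interpret prob_space M by fact
  have int: "integrable M X" if "X \<in> XX" for X
    using assms(2) that unfolding payoff_space_def by blast
  define \<mu> :: "real ^ 'm" where "\<mu> = (\<chi> j. expectation (\<lambda>\<omega>. P \<omega> $ j))"
  have G: "(\<lambda>\<omega>. q \<bullet> (P \<omega> - \<mu>)) \<in> XX" for q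
    using payoff_space_inner assms(2,5) by blast
  have EG: "expectation (\<lambda>\<omega>. q \<bullet> (P \<omega> - \<mu>)) = 0" for q
    unfolding \<mu>_def using assms(5) int by (intro expectation_inner_centered) blast
  have Z: "(\<lambda>\<omega>. - R i \<omega> - q \<bullet> (P \<omega> - \<mu>)) \<in> XX" if "i \<in> E" for i q
  proof -
    have "(\<lambda>\<omega>. - 1 * R i \<omega> + - 1 * (q \<bullet> (P \<omega> - \<mu>))) \<in> XX"
      by (intro payoff_space_cmult[OF assms(2)] payoff_space_add[OF assms(2)] assms(6)[OF that] G)
    then show ?thesis by simp
  qed
  \<comment> \<open>The redundant portfolios: their centred payoff vanishes, so holding them changes
    no position.\<close>
  define N where "N = {q. AE \<omega> in M. q \<bullet> (P \<omega> - \<mu>) = 0}"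
  have "subspace N"
    unfolding subspace_def N_def by (auto simp: inner_add_left)
  then obtain \<pi> where lin: "linear \<pi>" and idem: "\<And>q. \<pi> (\<pi> q) = \<pi> q"
      and inN: "\<And>q. q - \<pi> q \<in> N" and zero: "\<And>q. q \<in> N \<Longrightarrow> \<pi> q = 0"
    using projection_along_subspace by metis
  define h where "h i q = \<rho> i (\<lambda>\<omega>. - R i \<omega> - q \<bullet> (P \<omega> - \<mu>))" for i q
  have "coercive_along \<pi> (h i)" if i: "i \<in> E" for i
  proof (rule coercive_alongI[OF lin idem])
    note \<rho> = assms(7)[OF i]
    show "convex_on UNIV (h i)"
      unfolding convex_on_def
    proof (intro conjI ballI allI impI)
      fix x y :: "real ^ 'm" and u v :: real
      assume u: "0 \<le> u" "0 \<le> v" "u + v = 1"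
      then have v: "v = 1 - u" by simp
      have "(\<lambda>\<omega>. - R i \<omega> - (u *\<^sub>R x + v *\<^sub>R y) \<bullet> (P \<omega> - \<mu>))
          = (\<lambda>\<omega>. u * (- R i \<omega> - x \<bullet> (P \<omega> - \<mu>)) + (1 - u) * (- R i \<omega> - y \<bullet> (P \<omega> - \<mu>)))"
        by (simp add: fun_eq_iff v inner_add_left algebra_simps)
      then show "h i (u *\<^sub>R x + v *\<^sub>R y) \<le> u * h i x + v * h i y"
        using risk_measure_convex[OF \<rho> Z[OF i] Z[OF i], of u x y] u unfolding h_def v by simp
    qed simp
    show "h i (\<pi> q) = h i q" for q
    proof -
      have "AE \<omega> in M. (q - \<pi> q) \<bullet> (P \<omega> - \<mu>) = 0"
        using inN[of q] by (simp add: N_def)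
      then have "AE \<omega> in M. - R i \<omega> - \<pi> q \<bullet> (P \<omega> - \<mu>) = - R i \<omega> - q \<bullet> (P \<omega> - \<mu>)"
        by eventually_elim (simp add: inner_diff_left)
      then show ?thesis
        unfolding h_def by (intro risk_measure_cong_AE[OF \<rho>] Z i)
    qed
    show "\<exists>n::nat. c < h i (real n *\<^sub>R u)" if u: "\<pi> u = u" "u \<noteq> 0" for u c
    proof -
      \<comment> \<open>The sign is reversed because \<open>h i\<close> charges the loss
        \<open>- q \<bullet> (P \<omega> - \<mu>)\<close>; the receivable \<open>R i\<close> becomes
        the shift of the ray.\<close>
      let ?L = "\<lambda>\<omega>. (- u) \<bullet> (P \<omega> - \<mu>)"
      have "u \<notin> N" using zero[of u] u by auto
      then have "measure M {\<omega> \<in> space M. ?L \<omega> > 0} > 0"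
        by (intro measure_pos_of_centered int G EG) (simp add: N_def)
      from sensitive_shifted_ray[OF assms(2) \<rho> assms(10)[OF i] G this assms(6)[OF i], of c]
      show ?thesis by (simp add: h_def algebra_simps)
    qed
  qed
  then obtain q v where q: "(\<Sum>i\<in>E. q i) = 0"
      "\<And>i r. i \<in> E \<Longrightarrow> h i (q i) - v \<bullet> q i \<le> h i r - v \<bullet> r"
    using coercive_along_equilibrium[of \<pi> E h, OF lin idem assms(3,4)] by blast
  \<comment> \<open>Replacing \<open>\<mu>\<close> by the price \<open>\<mu> - v\<close> adds the
    constant \<open>- (v \<bullet> r)\<close> to the position, which translation invariance moves
    outside. Optimality at this price is thus the subgradient inequality for
    \<open>v\<close>.\<close>
  have "\<rho> i (\<lambda>\<omega>. - R i \<omega> + r \<bullet> (\<mu> - v - P \<omega>)) = h i r - v \<bullet> r" if i: "i \<in> E" for i r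
  proof -
    have "(\<lambda>\<omega>. - R i \<omega> + r \<bullet> (\<mu> - v - P \<omega>)) = (\<lambda>\<omega>. - R i \<omega> - r \<bullet> (P \<omega> - \<mu>) - v \<bullet> r)"
      by (simp add: fun_eq_iff inner_diff_right inner_commute[of v])
    then show ?thesis
      using assms(7)[OF i] Z[OF i] unfolding h_def risk_measure_def by simp
  qed
  with q have "radner_equilibrium E \<rho> R P q (\<mu> - v)"
    unfolding radner_equilibrium_def by simp
  then show ?thesis by blast
qed

end
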